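(* Let $0<\alpha\le\beta$, $\kappa=\beta/\alpha$, and let $n\ge2$ and $d\ge 1$ be integers. Let $f_1,\dots,f_{n-1},f_n\in\mathcal{F}_{\alpha,\beta}$ be functions on $\mathbb{R}^d$, let $f^-=\sum_{i=1}^{n-1}f_i$ and $f=f^-+f_n$. Let $x^*=\arg\min_x f(x)$ and $x^-=\arg\min_x f^-(x)$. Then $$\|x^*-x^-\|\le\min\left(2+2\sqrt{\kappa},\ \frac{2\sqrt{\kappa}+\kappa}{\sqrt{n-1}},\ \frac{2\kappa+\kappa^{3/2}}{n}\right).$$
   Context: $\|\cdot\|$ is the Euclidean norm. $\mathcal{F}_{\alpha,\beta}$ is the set of continuously differentiable functions $g:\mathbb{R}^d\to\mathbb{R}$ such that: $g$ is $\alpha$-strongly convex (i.e. $g(x)-\frac{\alpha}{2}\|x\|^2$ is convex); $g$ is $\beta$-smooth (i.e. $\|\nabla g(x)-\nabla g(y)\|\le\beta\|x-y\|$ for all $x,y$); $\min_x g(x)=0$; and the minimizer of $g$ has norm at most $1$. *)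

theory Defs
  imports "HOL-Analysis.Analysis"
begin

definition grad :: "('a::real_inner \<Rightarrow> real) \<Rightarrow> 'a \<Rightarrow> 'a" where
  "grad g x = (THE D. GDERIV g x :> D)"

lemma grad_eqI:
  assumes "GDERIV g x :> D"
  shows "grad g x = D"
  unfolding grad_def
proof (rule the_equality)
  show "GDERIV g x :> D" by fact
next
  fix E assume "GDERIV g x :> E"
  then have "(\<lambda>h. h \<bullet> E) = (\<lambda>h. h \<bullet> D)"
    using assms unfolding gderiv_def by (rule has_derivative_unique)
  then show "E = D"
    by (metis vector_eq_ldot)
qed

lemma GDERIV_grad:
  fixes g :: "'a::euclidean_space \<Rightarrow> real"
  assumes "g differentiable (at x)"
  shows "GDERIV g x :> grad g x"
proof -
  obtain g' where g': "(g has_derivative g') (at x)"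
    using assms unfolding differentiable_def by blast
  then have lin: "linear g'"
    by (rule has_derivative_linear)
  have "g' h = h \<bullet> adjoint g' 1" for h
    using adjoint_works[OF lin, of h 1] by simp
  then have "g' = (\<lambda>h. h \<bullet> adjoint g' 1)"
    by blast
  then have "GDERIV g x :> adjoint g' 1"
    using g' unfolding gderiv_def by metis
  then show ?thesis
    using grad_eqI by metis
qed

definition continuously_differentiable :: "('a::euclidean_space \<Rightarrow> real) \<Rightarrow> bool" where
  "continuously_differentiable g \<longleftrightarrow>
     (\<forall>x. g differentiable (at x)) \<and> continuous_on UNIV (grad g)"

definition strongly_convex :: "real \<Rightarrow> ('a::euclidean_space \<Rightarrow> real) \<Rightarrow> bool" where
  "strongly_convex \<alpha> g \<longleftrightarrow> convex_on UNIV (\<lambda>x. g x - \<alpha> / 2 * (norm x)\<^sup>2)"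

definition smooth :: "real \<Rightarrow> ('a::euclidean_space \<Rightarrow> real) \<Rightarrow> bool" where
  "smooth \<beta> g \<longleftrightarrow> (\<forall>x y. norm (grad g x - grad g y) \<le> \<beta> * norm (x - y))"

abbreviation is_minimizer :: "('a \<Rightarrow> real) \<Rightarrow> 'a \<Rightarrow> bool" where
  "is_minimizer g x \<equiv> is_arg_min g (\<lambda>_. True) x"

definition \<F> :: "real \<Rightarrow> real \<Rightarrow> ('a::euclidean_space \<Rightarrow> real) set" where
  "\<F> \<alpha> \<beta> = {g. continuously_differentiable g \<and> strongly_convex \<alpha> g \<and> smooth \<beta> g \<and>
     (\<exists>x. is_minimizer g x \<and> g x = 0) \<and>
     (\<forall>x. is_minimizer g x \<longrightarrow> norm x \<le> 1)}"

end

theory Submission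
  imports Defs
begin

text \<open>
  Each \<open>f\<^sub>i\<close> lies between the quadratics \<open>\<alpha>/2 \<parallel>x - p\<^sub>i\<parallel>\<^sup>2\<close> and \<open>\<beta>/2 \<parallel>x - p\<^sub>i\<parallel>\<^sup>2\<close> around its
  minimizer \<open>p\<^sub>i\<close>. Comparing the value at the minimizer with the value at \<open>0\<close> shows that the
  minimizer of any sum of the \<open>f\<^sub>i\<close> has norm at most \<open>1 + \<surd>\<kappa>\<close>; this gives the first bound.
  Hence \<open>\<parallel>x\<^sup>- - p\<^sub>n\<parallel> \<le> 2 + \<surd>\<kappa>\<close>. The second bound compares function values: strong convexity of
  \<open>f\<^sup>-\<close> yields \<open>(n-1) \<alpha>/2 \<parallel>x\<^sup>* - x\<^sup>-\<parallel>\<^sup>2 \<le> f\<^sub>n(x\<^sup>-)\<close>. The third compares gradients: strong convexity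
  of \<open>f\<close> and \<open>\<nabla>f(x\<^sup>-) = \<nabla>f\<^sub>n(x\<^sup>-)\<close> yield \<open>n \<alpha> \<parallel>x\<^sup>* - x\<^sup>-\<parallel> \<le> \<parallel>\<nabla>f\<^sub>n(x\<^sup>-)\<parallel>\<close>.
\<close>

section \<open>First-order inequalities by restriction to lines\<close>

lemma GDERIV_line:
  assumes "GDERIV g (x + t *\<^sub>R v) :> D"
  shows "((\<lambda>s. g (x + s *\<^sub>R v)) has_real_derivative (v \<bullet> D)) (at t)"
proof -
  have "((\<lambda>s. x + s *\<^sub>R v) has_derivative (\<lambda>h. h *\<^sub>R v)) (at t)"
    by (auto intro!: derivative_eq_intros)
  moreover have "(g has_derivative (\<lambda>h. h \<bullet> D)) (at (x + t *\<^sub>R v))"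
    using assms by (simp add: gderiv_def)
  ultimately have "((\<lambda>s. g (x + s *\<^sub>R v)) has_derivative (\<lambda>h. (h *\<^sub>R v) \<bullet> D)) (at t)"
    by (rule has_derivative_compose)
  then show ?thesis
    by (simp add: has_field_derivative_def mult_commute_abs)
qed

lemma norm_line_squared:
  fixes x v :: "'a::real_inner"
  shows "(norm (x + t *\<^sub>R v))\<^sup>2 = (norm x)\<^sup>2 + 2 * t * (x \<bullet> v) + t\<^sup>2 * (norm v)\<^sup>2"
  unfolding power2_norm_eq_inner
  by (simp add: inner_add_left inner_add_right inner_commute[of v x] power2_eq_square
      algebra_simps)

text \<open>On the line through \<open>x\<close> and \<open>y\<close>, \<open>g\<close> minus its
  quadratic is a convex function of one variable, so it lies above its tangent at parameter 0;
  evaluate at 1 and restore the quadratic. \<open>D\<close> is left free so that it can be 0 at a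
  minimizer or the gradient of one summand.\<close>

lemma strongly_convex_lower_bound:
  fixes g :: "'a::euclidean_space \<Rightarrow> real"
  assumes "strongly_convex \<alpha> g" and D: "GDERIV g x :> D"
  shows "g x + (y - x) \<bullet> D + \<alpha> / 2 * (norm (y - x))\<^sup>2 \<le> g y"
proof -
  define v where "v = y - x"
  define q where "q = (\<lambda>z. g z - \<alpha> / 2 * (norm z)\<^sup>2)"
  have "convex_on UNIV q"
    using assms(1) by (simp add: strongly_convex_def q_def)
  have cvx: "convex_on UNIV (\<lambda>t. q (x + t *\<^sub>R v))"
  proof (rule convex_onI)
    fix t a b :: real
    assume t: "0 < t" "t < 1"
    have "x + ((1 - t) *\<^sub>R a + t *\<^sub>R b) *\<^sub>R v = (1 - t) *\<^sub>R (x + a *\<^sub>R v) + t *\<^sub>R (x + b *\<^sub>R v)"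
      by (simp add: algebra_simps)
    then show "q (x + ((1 - t) *\<^sub>R a + t *\<^sub>R b) *\<^sub>R v)
        \<le> (1 - t) * q (x + a *\<^sub>R v) + t * q (x + b *\<^sub>R v)"
      using convex_onD[OF \<open>convex_on UNIV q\<close>, of t "x + a *\<^sub>R v" "x + b *\<^sub>R v"] t by simp
  qed simp
  have q_line: "q (x + t *\<^sub>R v) =
      g (x + t *\<^sub>R v) - \<alpha> / 2 * ((norm x)\<^sup>2 + 2 * t * (x \<bullet> v) + t\<^sup>2 * (norm v)\<^sup>2)" for t
    by (simp add: q_def norm_line_squared)
  have "((\<lambda>t. g (x + t *\<^sub>R v)) has_real_derivative (v \<bullet> D)) (at 0)"
    by (rule GDERIV_line) (simp add: D)
  then have "((\<lambda>t. q (x + t *\<^sub>R v)) has_real_derivative (v \<bullet> D - \<alpha> * (x \<bullet> v))) (at 0)"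
    unfolding q_line by (auto intro!: derivative_eq_intros)
  from convex_on_imp_above_tangent[OF cvx _ _ _ this, of 1]
  have "v \<bullet> D - \<alpha> * (x \<bullet> v) \<le> q (x + 1 *\<^sub>R v) - q (x + 0 *\<^sub>R v)"
    by simp
  then have "v \<bullet> D - \<alpha> * (x \<bullet> v) \<le> g (x + v) - g x - \<alpha> / 2 * (2 * (x \<bullet> v) + (norm v)\<^sup>2)"
    unfolding q_line by (simp add: algebra_simps)
  then show ?thesis
    by (simp add: v_def algebra_simps)
qed

text \<open>\<open>h\<close> is \<open>g\<close> along the segment minus its claimed quadratic
  growth. Cauchy-Schwarz and the Lipschitz gradient make its derivative nonpositive, so
  \<open>h 1\<close> is at most \<open>h 0\<close>; no integral is taken.\<close>

lemma smooth_upper_bound: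
  fixes g :: "'a::euclidean_space \<Rightarrow> real"
  assumes "smooth \<beta> g" and diff: "\<And>x. g differentiable (at x)"
  shows "g y \<le> g x + (y - x) \<bullet> grad g x + \<beta> / 2 * (norm (y - x))\<^sup>2"
proof -
  define v where "v = y - x"
  define h where "h = (\<lambda>t. g (x + t *\<^sub>R v) - t * (v \<bullet> grad g x) - \<beta> / 2 * t\<^sup>2 * (norm v)\<^sup>2)"
  have "h 1 \<le> h 0"
  proof (rule DERIV_nonpos_imp_nonincreasing[where f = h])
    fix t :: real
    assume t: "0 \<le> t"
    let ?d = "v \<bullet> grad g (x + t *\<^sub>R v) - v \<bullet> grad g x - \<beta> * t * (norm v)\<^sup>2"
    have "((\<lambda>s. g (x + s *\<^sub>R v)) has_real_derivative v \<bullet> grad g (x + t *\<^sub>R v)) (at t)"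
      by (intro GDERIV_line GDERIV_grad diff)
    then have "(h has_real_derivative ?d) (at t)"
      unfolding h_def by (auto intro!: derivative_eq_intros)
    moreover have "v \<bullet> (grad g (x + t *\<^sub>R v) - grad g x) \<le> norm v * (\<beta> * norm (t *\<^sub>R v))"
    proof -
      have "norm (grad g (x + t *\<^sub>R v) - grad g x) \<le> \<beta> * norm (t *\<^sub>R v)"
        using assms(1) unfolding smooth_def by (metis add_diff_cancel_left')
      then show ?thesis
        by (meson mult_left_mono norm_cauchy_schwarz norm_ge_zero order_trans)
    qed
    then have "?d \<le> 0"
      using t by (simp add: inner_diff_right power2_eq_square algebra_simps)
    ultimately show "\<exists>d. (h has_real_derivative d) (at t) \<and> d \<le> 0"
      by blast
  qed simp
  then show ?thesis
    by (simp add: h_def v_def)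
qed

section \<open>Minimizers and sums of strongly convex functions\<close>

lemma GDERIV_zero_at_minimizer:
  fixes g :: "'a::euclidean_space \<Rightarrow> real"
  assumes "is_minimizer g x" and "g differentiable (at x)"
  shows "GDERIV g x :> 0"
proof -
  obtain g' where g': "(g has_derivative g') (at x)"
    using assms(2) unfolding differentiable_def by blast
  have "\<forall>y. g x \<le> g y"
    using assms(1) by (auto simp: is_arg_min_linorder)
  then have "g' = (\<lambda>v. 0)"
    using differential_zero_maxmin[OF _ open_UNIV g'] by simp
  then show ?thesis
    using g' by (simp add: gderiv_def)
qed

lemma strongly_convex_minimizer_growth:
  fixes g :: "'a::euclidean_space \<Rightarrow> real"
  assumes "strongly_convex \<alpha> g" and "is_minimizer g x" and "g differentiable (at x)"
  shows "g x + \<alpha> / 2 * (norm (y - x))\<^sup>2 \<le> g y"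
  using strongly_convex_lower_bound[OF assms(1) GDERIV_zero_at_minimizer[OF assms(2,3)], of y]
  by simp

lemma strongly_convex_add:
  assumes "strongly_convex a g" and "strongly_convex b h"
  shows "strongly_convex (a + b) (\<lambda>x. g x + h x)"
proof -
  have "(\<lambda>x. (g x + h x) - (a + b) / 2 * (norm x)\<^sup>2) =
      (\<lambda>x. (g x - a / 2 * (norm x)\<^sup>2) + (h x - b / 2 * (norm x)\<^sup>2))"
    by (auto simp: algebra_simps add_divide_distrib)
  then show ?thesis
    using assms unfolding strongly_convex_def by (simp only: convex_on_add)
qed

text \<open>The modulus grows with the number of summands, which is the source of the denominators
  in the second and third bounds.\<close>

lemma strongly_convex_sum:
  assumes "finite I" and "\<And>i. i \<in> I \<Longrightarrow> strongly_convex \<alpha> (g i)"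
  shows "strongly_convex (real (card I) * \<alpha>) (\<lambda>x. \<Sum>i\<in>I. g i x)"
  using assms
proof (induction I rule: finite_induct)
  case empty
  then show ?case
    by (simp add: strongly_convex_def convex_on_const)
next
  case (insert j I)
  then show ?case
    using strongly_convex_add[of \<alpha> "g j" "real (card I) * \<alpha>" "\<lambda>x. \<Sum>i\<in>I. g i x"]
    by (simp add: algebra_simps)
qed

section \<open>Consequences of membership in \<open>\<F>\<close>\<close>

lemma \<F>_differentiable: "g \<in> \<F> \<alpha> \<beta> \<Longrightarrow> g differentiable (at x)"
  by (simp add: \<F>_def continuously_differentiable_def)

text \<open>At the minimizer \<open>p\<close> both value and gradient vanish, so the first-order
  inequalities based at \<open>p\<close> keep only their quadratic terms.\<close>

lemma \<F>_quadratic_bounds: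
  fixes g :: "'a::euclidean_space \<Rightarrow> real"
  assumes "g \<in> \<F> \<alpha> \<beta>"
  obtains p where "norm p \<le> 1"
    and "\<And>x. \<alpha> / 2 * (norm (x - p))\<^sup>2 \<le> g x"
    and "\<And>x. g x \<le> \<beta> / 2 * (norm (x - p))\<^sup>2"
    and "\<And>x. norm (grad g x) \<le> \<beta> * norm (x - p)"
proof -
  from assms obtain p where p: "is_minimizer g p" "g p = 0" "norm p \<le> 1"
    and sc: "strongly_convex \<alpha> g" and sm: "smooth \<beta> g"
    by (auto simp: \<F>_def)
  have diff: "g differentiable (at x)" for x
    using assms by (rule \<F>_differentiable)
  have grad_p: "grad g p = 0"
    by (rule grad_eqI[OF GDERIV_zero_at_minimizer[OF p(1) diff]])
  show thesis
  proof
    show "norm p \<le> 1" by fact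
    show "\<alpha> / 2 * (norm (x - p))\<^sup>2 \<le> g x" for x
      using strongly_convex_minimizer_growth[OF sc p(1) diff, of x] p(2) by simp
    show "g x \<le> \<beta> / 2 * (norm (x - p))\<^sup>2" for x
      using smooth_upper_bound[OF sm diff, of x p] p(2) grad_p by simp
    show "norm (grad g x) \<le> \<beta> * norm (x - p)" for x
      using sm grad_p unfolding smooth_def by (metis diff_zero)
  qed
qed

text \<open>Every summand has its minimizer in the unit ball, at distance at least
  \<open>norm x - 1\<close> from \<open>x\<close> and at most 1 from the origin. The number of
  summands cancels, so the same bound serves both \<open>f\<close> and
  \<open>fminus\<close>.\<close>

lemma norm_minimizer_sum_\<F>:
  fixes g :: "'i \<Rightarrow> 'a::euclidean_space \<Rightarrow> real"
  assumes "0 < \<alpha>" "0 \<le> \<beta>" and I: "finite I" "I \<noteq> {}"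
    and g: "\<And>i. i \<in> I \<Longrightarrow> g i \<in> \<F> \<alpha> \<beta>"
    and min: "is_minimizer (\<lambda>x. \<Sum>i\<in>I. g i x) x"
  shows "norm x \<le> 1 + sqrt (\<beta> / \<alpha>)"
proof (cases "norm x \<le> 1")
  case True
  then show ?thesis
    using assms(1,2) by (smt (verit) divide_nonneg_pos real_sqrt_ge_zero)
next
  case False
  have "\<alpha> / 2 * (norm x - 1)\<^sup>2 \<le> g i x \<and> g i 0 \<le> \<beta> / 2" if i: "i \<in> I" for i
  proof -
    obtain p where p: "norm p \<le> 1" "\<alpha> / 2 * (norm (x - p))\<^sup>2 \<le> g i x"
      "g i 0 \<le> \<beta> / 2 * (norm (0 - p))\<^sup>2"
      using \<F>_quadratic_bounds[OF g[OF i]] by metis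
    have "norm x - 1 \<le> norm (x - p)"
      using p(1) norm_triangle_ineq2[of x p] by linarith
    \<comment> \<open>Squaring is monotone here because the case assumption makes
      \<open>norm x - 1\<close> positive.\<close>
    then have "\<alpha> / 2 * (norm x - 1)\<^sup>2 \<le> \<alpha> / 2 * (norm (x - p))\<^sup>2"
      using False assms(1) by (intro mult_left_mono power_mono) auto
    moreover have "\<beta> / 2 * (norm (0 - p))\<^sup>2 \<le> \<beta> / 2 * 1"
      using p(1) assms(2) by (intro mult_left_mono) (auto simp: power_le_one)
    ultimately show ?thesis
      using p by linarith
  qed
  then have "real (card I) * (\<alpha> / 2 * (norm x - 1)\<^sup>2) \<le> (\<Sum>i\<in>I. g i x)"
    and "(\<Sum>i\<in>I. g i 0) \<le> real (card I) * (\<beta> / 2)"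
    by (blast intro: sum_bounded_below sum_bounded_above)+
  moreover have "(\<Sum>i\<in>I. g i x) \<le> (\<Sum>i\<in>I. g i 0)"
    using min by (auto simp: is_arg_min_linorder)
  ultimately have "real (card I) * (\<alpha> / 2 * (norm x - 1)\<^sup>2) \<le> real (card I) * (\<beta> / 2)"
    by linarith
  then have "\<alpha> / 2 * (norm x - 1)\<^sup>2 \<le> \<beta> / 2"
    using I by (simp add: card_gt_0_iff)
  then have "(norm x - 1)\<^sup>2 \<le> \<beta> / \<alpha>"
    using assms(1) by (simp add: field_simps)
  then have "norm x - 1 \<le> sqrt (\<beta> / \<alpha>)"
    by (rule real_le_rsqrt)
  then show ?thesis by simp
qed

section \<open>Stability of the minimizer when one summand is added\<close>

theorem theorem5:
  fixes \<alpha> \<beta> \<kappa> :: real and n :: nat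
    and fs :: "nat \<Rightarrow> real ^ 'd \<Rightarrow> real"
    and f fminus :: "real ^ 'd \<Rightarrow> real"
    and xstar xminus :: "real ^ 'd"
  assumes "0 < \<alpha>" and "\<alpha> \<le> \<beta>" and "\<kappa> = \<beta> / \<alpha>"
    and "n \<ge> 2"
    and "\<And>i. i \<in> {1..n} \<Longrightarrow> fs i \<in> \<F> \<alpha> \<beta>"
    and "fminus = (\<lambda>x. \<Sum>i=1..n-1. fs i x)"
    and "f = (\<lambda>x. fminus x + fs n x)"
    and "is_minimizer f xstar"
    and "is_minimizer fminus xminus"
  shows "norm (xstar - xminus) \<le>
    min (2 + 2 * sqrt \<kappa>)
      (min ((2 * sqrt \<kappa> + \<kappa>) / sqrt (real n - 1))
           ((2 * \<kappa> + \<kappa> powr (3 / 2)) / real n))"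
proof -
  define d where "d = norm (xstar - xminus)"
  \<comment> \<open>In terms of \<open>s\<close> all powers of \<kappa> are polynomial: the last two
    numerators are \<open>s * (2 + s)\<close> and \<open>s\<^sup>2 * (2 + s)\<close>.\<close>
  define s where "s = sqrt \<kappa>"
  have "\<kappa> > 0" "s > 0" and \<kappa>: "\<kappa> = s\<^sup>2" and \<beta>: "\<beta> = s\<^sup>2 * \<alpha>"
    using assms(1-3) by (auto simp: s_def)
  have s3: "\<kappa> powr (3 / 2) = s ^ 3"
  proof -
    have "\<kappa> powr (3 / 2) = (\<kappa> powr (1 / 2)) powr 3"
      by (simp add: powr_powr)
    then show ?thesis
      using \<open>\<kappa> > 0\<close> by (simp add: s_def powr_half_sqrt)
  qed
  have n: "{1..n} = insert n {1..n - 1}" "n \<notin> {1..n - 1}" "real (n - 1) = real n - 1"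
    using assms(4) by auto
  have f: "f = (\<lambda>x. \<Sum>i=1..n. fs i x)"
    unfolding n(1) using n(2) by (simp add: assms(6,7) add.commute)

  have diff: "fs i differentiable (at x)" if "i \<in> {1..n}" for i x
    using assms(5)[OF that] by (rule \<F>_differentiable)
  then have diff_minus: "fminus differentiable (at x)" for x
    unfolding assms(6) by (intro differentiable_sum) auto
  have diff_f: "f differentiable (at x)" for x
    unfolding f by (intro differentiable_sum) (auto intro!: diff)
  have sc: "strongly_convex \<alpha> (fs i)" if "i \<in> {1..n}" for i
    using assms(5)[OF that] by (simp add: \<F>_def)
  have sc_minus: "strongly_convex ((real n - 1) * \<alpha>) fminus"
    using strongly_convex_sum[of "{1..n - 1}" \<alpha> fs] sc n(3) unfolding assms(6) by auto
  have sc_f: "strongly_convex (real n * \<alpha>) f"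
    using strongly_convex_sum[of "{1..n}" \<alpha> fs] sc unfolding f by auto

  have xstar: "norm xstar \<le> 1 + s"
    using norm_minimizer_sum_\<F>[of \<alpha> \<beta> "{1..n}" fs xstar] assms(1-5,8) f by (simp add: s_def)
  have xminus: "norm xminus \<le> 1 + s"
    unfolding s_def assms(3)
    by (rule norm_minimizer_sum_\<F>[where I = "{1..n - 1}" and g = fs])
      (use assms(1,2,4-6,9) in auto)

  obtain p where p: "norm p \<le> 1"
    and val: "0 \<le> fs n xstar" "fs n xminus \<le> \<beta> / 2 * (norm (xminus - p))\<^sup>2"
    and gr: "norm (grad (fs n) xminus) \<le> \<beta> * norm (xminus - p)"
  proof -
    have "fs n \<in> \<F> \<alpha> \<beta>"
      using assms(4,5) by simp
    then obtain p where p: "norm p \<le> 1"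
      "\<And>x. \<alpha> / 2 * (norm (x - p))\<^sup>2 \<le> fs n x"
      "\<And>x. fs n x \<le> \<beta> / 2 * (norm (x - p))\<^sup>2"
      "\<And>x. norm (grad (fs n) x) \<le> \<beta> * norm (x - p)"
      using \<F>_quadratic_bounds by blast
    have "0 \<le> \<alpha> / 2 * (norm (xstar - p))\<^sup>2"
      using assms(1) by simp
    then show thesis
      using that[of p] p order_trans by blast
  qed
  \<comment> \<open>The constant is (1 + \<open>s\<close>) + 1; it becomes the factor
    \<open>2 + s\<close> in both numerators.\<close>
  have dist_p: "norm (xminus - p) \<le> 2 + s"
    using norm_triangle_ineq4[of xminus p] xminus p by linarith

  have "d \<le> 2 + 2 * s"
    unfolding d_def using norm_triangle_ineq4[of xstar xminus] xstar xminus by linarith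
  moreover have "d \<le> (2 * s + s\<^sup>2) / sqrt (real n - 1)"
  proof -
    have "fminus xminus + (real n - 1) * \<alpha> / 2 * d\<^sup>2 \<le> fminus xstar"
      unfolding d_def
      by (rule strongly_convex_minimizer_growth[OF sc_minus assms(9) diff_minus])
    \<comment> \<open>Optimality of \<open>xstar\<close> bounds the increase of
      \<open>fminus\<close> by \<open>fs n xminus - fs n xstar\<close>, hence by
      \<open>fs n xminus\<close>.\<close>
    moreover have "f xstar \<le> f xminus"
      using assms(8) by (auto simp: is_arg_min_linorder)
    ultimately have "(real n - 1) * \<alpha> / 2 * d\<^sup>2 \<le> \<beta> / 2 * (norm (xminus - p))\<^sup>2"
      using val by (simp add: assms(7))
    also have "\<dots> \<le> \<beta> / 2 * (2 + s)\<^sup>2"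
      using dist_p assms(1,2) by (intro mult_left_mono power_mono) auto
    \<comment> \<open>Substituting \<beta> = \<open>s\<^sup>2 * \<alpha>\<close> makes the right
      side \<alpha> times a perfect square, ready for a square root.\<close>
    finally have "\<alpha> * ((real n - 1) * d\<^sup>2) \<le> \<alpha> * (s * (2 + s))\<^sup>2"
      by (simp add: \<beta> power_mult_distrib ac_simps)
    then have "(real n - 1) * d\<^sup>2 \<le> (s * (2 + s))\<^sup>2"
      using assms(1) by simp
    then have "(d * sqrt (real n - 1))\<^sup>2 \<le> (s * (2 + s))\<^sup>2"
      using assms(4) by (simp add: power_mult_distrib mult.commute)
    then have "d * sqrt (real n - 1) \<le> s * (2 + s)"
      by (rule power2_le_imp_le) (use \<open>s > 0\<close> in simp)
    then show ?thesis
      using assms(4) by (simp add: pos_le_divide_eq power2_eq_square algebra_simps)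
  qed
  moreover have "d \<le> (2 * s\<^sup>2 + s ^ 3) / real n"
  proof -
    let ?D = "grad (fs n) xminus"
    have "GDERIV fminus xminus :> 0"
      by (rule GDERIV_zero_at_minimizer[OF assms(9) diff_minus])
    moreover have "GDERIV (fs n) xminus :> ?D"
      using assms(4) by (intro GDERIV_grad diff) simp
    ultimately have "GDERIV f xminus :> 0 + ?D"
      unfolding assms(7) by (rule GDERIV_add)
    then have "f xminus + (xstar - xminus) \<bullet> ?D + real n * \<alpha> / 2 * d\<^sup>2 \<le> f xstar"
      using strongly_convex_lower_bound[OF sc_f, of xminus ?D xstar] by (simp add: d_def)
    \<comment> \<open>Strong convexity is used from both endpoints: adding the two inequalities
      cancels the values of \<open>f\<close> and doubles the quadratic term.\<close>
    moreover have "f xstar + real n * \<alpha> / 2 * d\<^sup>2 \<le> f xminus"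
      using strongly_convex_minimizer_growth[OF sc_f assms(8) diff_f, of xminus]
      by (simp add: d_def norm_minus_commute)
    ultimately have "real n * \<alpha> * d\<^sup>2 \<le> - ((xstar - xminus) \<bullet> ?D)"
      by (simp add: algebra_simps)
    also have "\<dots> \<le> d * norm ?D"
      unfolding d_def using Cauchy_Schwarz_ineq2[of "xstar - xminus" ?D] by linarith
    also have "\<dots> \<le> d * (\<beta> * (2 + s))"
    proof (rule mult_left_mono)
      have "\<beta> * norm (xminus - p) \<le> \<beta> * (2 + s)"
        using dist_p assms(1,2) by (intro mult_left_mono) auto
      then show "norm ?D \<le> \<beta> * (2 + s)"
        using gr by linarith
    qed (simp add: d_def)
    finally have *: "(\<alpha> * d) * (d * real n) \<le> (\<alpha> * d) * (s\<^sup>2 * (2 + s))"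
      by (simp add: \<beta> power2_eq_square algebra_simps)
    \<comment> \<open>One factor \<open>d\<close> has to be cancelled, so the case of coinciding
      minimizers is split off.\<close>
    show ?thesis
    proof (cases "d = 0")
      case True
      then show ?thesis
        using \<open>s > 0\<close> by simp
    next
      case False
      then have "\<alpha> * d > 0"
        using assms(1) by (simp add: d_def)
      then have "d * real n \<le> s\<^sup>2 * (2 + s)"
        using * by (simp only: mult_le_cancel_left_pos)
      then show ?thesis
        using assms(4)
        by (simp add: pos_le_divide_eq power2_eq_square power3_eq_cube algebra_simps)
    qed
  qed
  ultimately have "d \<le> min (2 + 2 * s)
      (min ((2 * s + s\<^sup>2) / sqrt (real n - 1)) ((2 * s\<^sup>2 + s ^ 3) / real n))"
    by (intro min.boundedI)
  then show ?thesis
    unfolding s3 d_def[symmetric] \<kappa>[symmetric] s_def[symmetric] .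
qed

end
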